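(* Let $p\in\mathbb{R}$. The inequality $L_p(a,b)<P(a,b)$ holds for all $a,b>0$ with $a\neq b$ if and only if $p\le 2$.
   Context: For $a,b>0$ with $a\ne b$ the logarithmic mean is $L(a,b)=\dfrac{a-b}{\ln a-\ln b}$ and the first Seiffert mean is $P(a,b)=\dfrac{a-b}{2\arcsin\frac{a-b}{a+b}}$, with $L(a,a)=P(a,a)=a$. For $p\in\mathbb{R}$, $L_p(a,b)=\left(L(a^p,b^p)\right)^{1/p}$ if $p\neq0$ and $L_0(a,b)=\sqrt{ab}$. *)

theory Defs
  imports Complex_Main
begin

text \<open>Means of two positive reals; the values at other arguments carry no meaning.\<close>

definition log_mean :: "real \<Rightarrow> real \<Rightarrow> real" where
  "log_mean a b = (if a = b then a else (a - b) / (ln a - ln b))"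

definition seiffert_mean :: "real \<Rightarrow> real \<Rightarrow> real" where
  "seiffert_mean a b = (if a = b then a else (a - b) / (2 * arcsin ((a - b) / (a + b))))"

definition power_log_mean :: "real \<Rightarrow> real \<Rightarrow> real \<Rightarrow> real" where
  "power_log_mean p a b =
     (if p = 0 then sqrt (a * b) else (log_mean (a powr p) (b powr p)) powr (1 / p))"

end

theory Submission
  imports Defs "HOL-Real_Asymp.Real_Asymp"
begin

text \<open>
  All three means are homogeneous, so write \<open>a = G e\<^sup>t\<close> and \<open>b = G / e\<^sup>t\<close>, where \<open>G\<close> is the
  geometric mean of \<open>a\<close> and \<open>b\<close>. Symmetry in \<open>a\<close> and \<open>b\<close> allows \<open>t > 0\<close>. After division by
  \<open>G\<close>, the mean \<open>L\<^sub>p\<close> becomes \<open>(sinh(pt)/(pt)) powr (1/p)\<close> and the Seiffert mean becomes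
  \<open>sinh t / gd t\<close>, where \<open>gd t = arctan (sinh t) = arcsin (tanh t)\<close> is the Gudermannian function,
  the integral of \<open>1 / cosh\<close> from \<open>0\<close> to \<open>t\<close>.

  For \<open>p = 2\<close> the claim turns, by the double angle formula, into \<open>(gd t)\<^sup>2 < t tanh t\<close>. This is
  the Cauchy-Schwarz inequality: the square of the integral of \<open>1 / cosh\<close> over \<open>[0, t]\<close> is less
  than \<open>t\<close> times the integral of \<open>1 / cosh\<^sup>2\<close>, which is \<open>tanh t\<close>
  (\<open>arctan_sinh_squared_less\<close>). The case \<open>0 < p < 2\<close> follows because \<open>L\<^sub>p\<close> increases
  with \<open>p\<close> (\<open>sinh_quotient_powr_mono\<close>), and for \<open>p \<le> 0\<close> it is enough that
  \<open>L\<^sub>p \<le> G \<le> L\<^sub>2\<close>, a consequence of \<open>x < sinh x\<close>.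

  The bound \<open>p \<le> 2\<close> is forced by arguments that are close to each other: as \<open>t\<close> tends to \<open>0\<close>,
  \<open>ln (L\<^sub>p / G)\<close> behaves like \<open>p t\<^sup>2 / 6\<close> and the logarithm of the Seiffert mean over \<open>G\<close> like
  \<open>t\<^sup>2 / 3\<close>, so for \<open>p > 2\<close> the inequality is reversed near \<open>t = 0\<close>
  (\<open>eventually_seiffert_less_power_log\<close>).
\<close>

section \<open>The means in hyperbolic coordinates\<close>

lemma self_less_sinh:
  fixes x :: real
  assumes "x > 0"
  shows "x < sinh x"
proof -
  have "sinh 0 - 0 < sinh x - x"
  proof (rule DERIV_pos_imp_increasing_open[OF assms])
    fix y :: real
    assume "0 < y"
    hence "cosh 0 < cosh y"
      by (subst cosh_real_nonneg_less_iff) auto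
    thus "\<exists>d. ((\<lambda>y. sinh y - y) has_real_derivative d) (at y) \<and> d > 0"
      by (intro exI[of _ "cosh y - 1"]) (auto intro!: derivative_eq_intros)
  qed (auto intro!: continuous_intros)
  thus ?thesis by simp
qed

lemma sinh_quotient_gt_one:
  fixes x :: real
  assumes "x \<noteq> 0"
  shows "1 < sinh x / x"
proof (cases "x > 0")
  case True
  thus ?thesis using self_less_sinh[of x] by simp
next
  case False
  thus ?thesis using self_less_sinh[of "- x"] assms by (simp add: less_divide_eq)
qed

lemma power_log_mean_exp:
  fixes p t G :: real
  assumes "G > 0" "t \<noteq> 0" "p \<noteq> 0"
  shows "power_log_mean p (G * exp t) (G * exp (- t)) =
         G * (sinh (p * t) / (p * t)) powr (1 / p)"
proof -
  have pows: "(G * exp t) powr p = G powr p * exp (p * t)"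
             "(G * exp (- t)) powr p = G powr p * exp (- (p * t))"
    using assms by (simp_all add: powr_mult exp_powr_real mult.commute)
  have pos: "sinh (p * t) / (p * t) > 0"
    using assms sinh_quotient_gt_one[of "p * t"] by simp
  have "log_mean ((G * exp t) powr p) ((G * exp (- t)) powr p) =
        G powr p * (exp (p * t) - exp (- (p * t))) / (2 * (p * t))"
    using assms unfolding pows log_mean_def
    by (simp add: ln_mult ln_powr right_diff_distrib)
  also have "\<dots> = G powr p * (sinh (p * t) / (p * t))"
    by (simp add: sinh_field_def)
  finally have "power_log_mean p (G * exp t) (G * exp (- t)) =
        (G powr p * (sinh (p * t) / (p * t))) powr (1 / p)"
    using assms unfolding power_log_mean_def by presburger
  also have "\<dots> = (G powr p) powr (1 / p) * (sinh (p * t) / (p * t)) powr (1 / p)"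
    using pos by (intro powr_mult)
  finally show ?thesis
    using assms by (simp add: powr_powr)
qed

text \<open>The quotient \<open>(a - b) / (a + b)\<close> becomes \<open>tanh t\<close>, and \<open>sin (arctan (sinh t)) = tanh t\<close>.\<close>

lemma seiffert_mean_exp:
  fixes t G :: real
  assumes "G > 0" "t \<noteq> 0"
  shows "seiffert_mean (G * exp t) (G * exp (- t)) = G * (sinh t / arctan (sinh t))"
proof -
  have "sin (arctan (sinh t)) = sinh t / sqrt (1 + (sinh t)\<^sup>2)"
    by (simp add: sin_arctan)
  also have "1 + (sinh t)\<^sup>2 = (cosh t)\<^sup>2"
    by (simp add: cosh_square_eq)
  finally have "sin (arctan (sinh t)) = sinh t / cosh t"
    by simp
  hence gd: "arcsin (sinh t / cosh t) = arctan (sinh t)"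
    using arctan_bounded[of "sinh t"] by (metis arcsin_sin less_eq_real_def)
  have dif: "G * exp t - G * exp (- t) = 2 * G * sinh t"
    and sm: "G * exp t + G * exp (- t) = 2 * G * cosh t"
    by (simp_all add: sinh_field_def cosh_field_def algebra_simps)
  have ne: "G * exp t \<noteq> G * exp (- t)"
    using assms by simp
  have "(2 * G * sinh t) / (2 * G * cosh t) = sinh t / cosh t"
    using assms by simp
  thus ?thesis
    using ne unfolding seiffert_mean_def dif sm by (simp add: gd)
qed

section \<open>The logarithmic mean of order two\<close>

text \<open>
  This is the Cauchy-Schwarz inequality described above. Differentiation gives a direct proof. The
  derivative of \<open>t tanh t - (arctan (sinh t))\<^sup>2\<close> is a positive multiple of
  \<open>sinh t + t / cosh t - 2 arctan (sinh t)\<close>. A second differentiation removes the arctangent and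
  leaves the sign of \<open>sinh t cosh t - t\<close>.
\<close>

lemma arctan_sinh_squared_less:
  fixes t :: real
  assumes "t > 0"
  shows "(arctan (sinh t))\<^sup>2 < t * tanh t"
proof -
  have d_arctan: "((\<lambda>x. arctan (sinh x)) has_real_derivative 1 / cosh x) (at x)" for x :: real
  proof -
    have "1 + (sinh x)\<^sup>2 = (cosh x)\<^sup>2" by (simp add: cosh_square_eq)
    thus ?thesis
      by (auto intro!: derivative_eq_intros simp: field_simps power2_eq_square)
  qed
  have inner: "2 * arctan (sinh x) < sinh x + x / cosh x" if "x > 0" for x :: real
  proof -
    have "sinh 0 + 0 / cosh 0 - 2 * arctan (sinh 0) < sinh x + x / cosh x - 2 * arctan (sinh x)"
    proof (rule DERIV_pos_imp_increasing_open[OF that])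
      fix y :: real
      assume y: "0 < y"
      have "y < sinh y * cosh y"
      proof -
        have "y < sinh y" by (rule self_less_sinh[OF y])
        also have "\<dots> \<le> sinh y * cosh y"
          using y cosh_real_ge_1[of y] by simp
        finally show ?thesis .
      qed
      hence "y * sinh y < (sinh y)\<^sup>2 * cosh y"
        using y by (simp add: power2_eq_square mult.commute)
      hence "0 < ((sinh y)\<^sup>2 * cosh y - y * sinh y) / (cosh y)\<^sup>2"
        by simp
      moreover have "((\<lambda>y. sinh y + y / cosh y - 2 * arctan (sinh y)) has_real_derivative
          cosh y + (cosh y - y * sinh y) / (cosh y)\<^sup>2 - 2 * (1 / cosh y)) (at y)"
        by (rule derivative_eq_intros d_arctan refl | simp add: power2_eq_square)+
      moreover have "cosh y + (cosh y - y * sinh y) / (cosh y)\<^sup>2 - 2 * (1 / cosh y) =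
          ((sinh y)\<^sup>2 * cosh y - y * sinh y) / (cosh y)\<^sup>2"
        unfolding sinh_square_eq by (simp add: field_simps power2_eq_square)
      ultimately show "\<exists>d. ((\<lambda>y. sinh y + y / cosh y - 2 * arctan (sinh y))
          has_real_derivative d) (at y) \<and> d > 0"
        by metis
    qed (auto intro!: continuous_intros)
    thus ?thesis by simp
  qed
  have "0 * tanh 0 - (arctan (sinh 0))\<^sup>2 < t * tanh t - (arctan (sinh t))\<^sup>2"
  proof (rule DERIV_pos_imp_increasing_open[OF assms])
    fix x :: real
    assume x: "0 < x"
    have "((\<lambda>x. x * tanh x - (arctan (sinh x))\<^sup>2) has_real_derivative
        tanh x + x * (1 - (tanh x)\<^sup>2) - 2 * arctan (sinh x) * (1 / cosh x)) (at x)"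
      by (rule derivative_eq_intros d_arctan refl | simp)+
    moreover have "tanh x + x * (1 - (tanh x)\<^sup>2) - 2 * arctan (sinh x) * (1 / cosh x) =
        (sinh x + x / cosh x - 2 * arctan (sinh x)) / cosh x"
    proof -
      have "1 - (tanh x)\<^sup>2 = 1 / (cosh x)\<^sup>2"
        by (simp add: tanh_def power_divide sinh_square_eq diff_divide_distrib)
      thus ?thesis
        by (simp add: tanh_def diff_divide_distrib add_divide_distrib power2_eq_square)
    qed
    moreover have "(sinh x + x / cosh x - 2 * arctan (sinh x)) / cosh x > 0"
      using inner[OF x] by simp
    ultimately show "\<exists>d. ((\<lambda>x. x * tanh x - (arctan (sinh x))\<^sup>2)
        has_real_derivative d) (at x) \<and> d > 0"
      by metis
  qed (auto intro!: continuous_intros)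
  thus ?thesis by simp
qed

lemma sqrt_sinh_quotient_less:
  fixes t :: real
  assumes "t > 0"
  shows "sqrt (sinh (2 * t) / (2 * t)) < sinh t / arctan (sinh t)"
proof -
  have s: "sinh t > 0" and A: "arctan (sinh t) > 0"
    using assms by simp_all
  have "(arctan (sinh t))\<^sup>2 * cosh t < t * sinh t"
    using arctan_sinh_squared_less[OF assms] by (simp add: tanh_def field_simps)
  hence "sinh t * ((arctan (sinh t))\<^sup>2 * cosh t) < sinh t * (t * sinh t)"
    using s by simp
  hence "sinh (2 * t) / (2 * t) < (sinh t / arctan (sinh t))\<^sup>2"
    using assms s A unfolding sinh_double by (simp add: field_simps power2_eq_square)
  thus ?thesis
    using s A by (intro real_less_lsqrt) auto
qed

section \<open>Dependence on the order\<close>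

text \<open>
  With \<open>\<phi> x = ln (sinh x / x)\<close>, the claim says that \<open>\<phi> x / x\<close> is nondecreasing on the positive
  reals, which holds because \<open>\<phi>\<close> is convex and tends to \<open>0\<close> at \<open>0\<close>. In the proof convexity appears
  as the monotonicity of \<open>h x = x \<phi>' x - \<phi> x\<close>, the numerator of the derivative of \<open>\<phi> x / x\<close>:
  \<open>h' x = x \<phi>'' x = 1 / x - x / (sinh x)\<^sup>2\<close>.
\<close>

lemma sinh_quotient_powr_mono:
  fixes p q t :: real
  assumes "t > 0" "0 < p" "p \<le> q"
  shows "(sinh (p * t) / (p * t)) powr (1 / p) \<le> (sinh (q * t) / (q * t)) powr (1 / q)"
proof -
  define \<phi> where "\<phi> = (\<lambda>x::real. ln (sinh x / x))"
  define h where "h = (\<lambda>x::real. x * cosh x / sinh x - 1 - \<phi> x)"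
  have d\<phi>: "(\<phi> has_real_derivative cosh x / sinh x - 1 / x) (at x)" if "x > 0" for x
    using that unfolding \<phi>_def
    by (auto intro!: derivative_eq_intros simp: field_simps power2_eq_square)
  have h_mono: "h x \<le> h y" if "0 < x" "x \<le> y" for x y
  proof (rule DERIV_nonneg_imp_nondecreasing[OF that(2)])
    fix z assume "x \<le> z"
    hence z: "z > 0" using that by simp
    have "(h has_real_derivative
        ((cosh z + z * sinh z) * sinh z - z * cosh z * cosh z) / (sinh z * sinh z)
        - (cosh z / sinh z - 1 / z)) (at z)"
      unfolding h_def using z d\<phi>[OF z]
      by (auto intro!: derivative_eq_intros simp: field_simps)
    moreover have "((cosh z + z * sinh z) * sinh z - z * cosh z * cosh z) / (sinh z * sinh z)
        - (cosh z / sinh z - 1 / z) = 1 / z - z / (sinh z)\<^sup>2"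
      using z cosh_square_eq[of z] by (simp add: field_simps power2_eq_square)
    moreover have "1 / z - z / (sinh z)\<^sup>2 \<ge> 0"
    proof -
      have "z * z \<le> sinh z * sinh z"
        using self_less_sinh[OF z] z by (intro mult_mono) auto
      thus ?thesis using z by (simp add: field_simps power2_eq_square)
    qed
    ultimately show "\<exists>d. (h has_real_derivative d) (at z) \<and> 0 \<le> d" by metis
  qed
  have h_lim: "(h \<longlongrightarrow> 0) (at_right 0)"
    unfolding h_def \<phi>_def by real_asymp
  \<comment> \<open>Division by zero gives the quotients in \<open>h\<close> the default value \<open>0\<close> at \<open>0\<close>, so \<open>h x\<close> is
    compared with the limit of \<open>h\<close> there and not with \<open>h 0\<close>.\<close>
  have h_nonneg: "h x \<ge> 0" if "x > 0" for x
  proof (rule tendsto_upperbound[OF h_lim])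
    show "\<forall>\<^sub>F y in at_right 0. h y \<le> h x"
      using eventually_at_right_less[of 0] eventually_at_right_real[OF that]
      by eventually_elim (auto intro: h_mono)
  qed simp
  have "p * t \<le> q * t"
    using assms by simp
  hence "\<phi> (p * t) / (p * t) \<le> \<phi> (q * t) / (q * t)"
  proof (rule DERIV_nonneg_imp_nondecreasing)
    fix x assume "p * t \<le> x"
    moreover have "p * t > 0" using assms by simp
    ultimately have x: "x > 0" by linarith
    have "((\<lambda>x. \<phi> x / x) has_real_derivative h x / x\<^sup>2) (at x)"
      using x d\<phi>[OF x] unfolding h_def
      by (auto intro!: derivative_eq_intros simp: field_simps power2_eq_square)
    thus "\<exists>d. ((\<lambda>x. \<phi> x / x) has_real_derivative d) (at x) \<and> 0 \<le> d"
      using h_nonneg[OF x] by (intro exI[of _ "h x / x\<^sup>2"]) simp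
  qed
  hence "\<phi> (p * t) / p \<le> \<phi> (q * t) / q"
    using assms by (simp add: field_simps)
  moreover have "sinh (p * t) / (p * t) > 0" "sinh (q * t) / (q * t) > 0"
    using assms by simp_all
  ultimately show ?thesis
    using assms by (simp add: powr_def \<phi>_def)
qed

lemma power_log_mean_less_seiffert_mean:
  fixes p t G :: real
  assumes "p \<le> 2" "t > 0" "G > 0"
  shows "power_log_mean p (G * exp t) (G * exp (- t)) < seiffert_mean (G * exp t) (G * exp (- t))"
proof -
  define S where "S = sinh t / arctan (sinh t)"
  have two: "sqrt (sinh (2 * t) / (2 * t)) < S"
    unfolding S_def using assms by (intro sqrt_sinh_quotient_less)
  have "1 \<le> sqrt (sinh (2 * t) / (2 * t))"
    using self_less_sinh[of "2 * t"] assms by simp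
  \<comment> \<open>In units of the geometric mean \<open>G\<close> this is \<open>G < S\<close>; it settles all orders \<open>p \<le> 0\<close>.\<close>
  hence one: "1 < S" using two by (rule le_less_trans)
  have Sm: "seiffert_mean (G * exp t) (G * exp (- t)) = G * S"
    unfolding S_def using assms by (intro seiffert_mean_exp) auto
  consider "p = 0" | "p < 0" | "p > 0" by linarith
  thus ?thesis
  proof cases
    assume "p = 0"
    hence "power_log_mean p (G * exp t) (G * exp (- t)) = sqrt (G * G * (exp t * exp (- t)))"
      by (simp add: power_log_mean_def mult_ac)
    also have "\<dots> = G"
      using assms by (simp add: exp_minus)
    finally show ?thesis unfolding Sm using one assms by simp
  next
    assume p: "p < 0"
    have "1 < sinh (p * t) / (p * t)"
      using p assms by (intro sinh_quotient_gt_one) simp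
    hence "(sinh (p * t) / (p * t)) powr (1 / p) \<le> 1"
      using p powr_mono2'[of "1 / p" 1 "sinh (p * t) / (p * t)"] by simp
    hence "(sinh (p * t) / (p * t)) powr (1 / p) < S" using one by linarith
    thus ?thesis unfolding Sm using p assms by (simp add: power_log_mean_exp)
  next
    assume p: "p > 0"
    have "(sinh (p * t) / (p * t)) powr (1 / p) \<le> (sinh (2 * t) / (2 * t)) powr (1 / 2)"
      using p assms by (intro sinh_quotient_powr_mono) auto
    also have "\<dots> = sqrt (sinh (2 * t) / (2 * t))"
      using assms by (intro powr_half_sqrt) simp
    also note two
    finally show ?thesis unfolding Sm using p assms by (simp add: power_log_mean_exp)
  qed
qed

text \<open>
  The logarithms of both sides vanish to second order at \<open>0\<close>; their leading coefficients \<open>1/3\<close>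
  and \<open>p/6\<close> decide the comparison.
\<close>

lemma eventually_seiffert_less_power_log:
  fixes p :: real
  assumes "p > 2"
  shows "\<forall>\<^sub>F t in at_right 0. sinh t / arctan (sinh t) < (sinh (p * t) / (p * t)) powr (1 / p)"
proof -
  have "((\<lambda>t::real. ln (sinh (p * t) / (p * t)) / p / t\<^sup>2) \<longlongrightarrow> p / 6) (at_right 0)"
    using assms by (real_asymp simp: field_simps)
  moreover have "((\<lambda>t::real. ln (sinh t / arctan (sinh t)) / t\<^sup>2) \<longlongrightarrow> 1 / 3) (at_right 0)"
    by real_asymp
  ultimately have "((\<lambda>t. ln (sinh (p * t) / (p * t)) / p / t\<^sup>2 - ln (sinh t / arctan (sinh t)) / t\<^sup>2)
      \<longlongrightarrow> p / 6 - 1 / 3) (at_right 0)"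
    by (rule tendsto_diff)
  hence "\<forall>\<^sub>F t in at_right 0.
      0 < ln (sinh (p * t) / (p * t)) / p / t\<^sup>2 - ln (sinh t / arctan (sinh t)) / t\<^sup>2"
    using assms by (intro order_tendstoD(1)) auto
  thus ?thesis
    using eventually_at_right_less[of 0]
  proof eventually_elim
    case (elim t)
    have pos: "sinh t / arctan (sinh t) > 0" "sinh (p * t) / (p * t) > 0"
      using elim assms by simp_all
    have "0 < (ln (sinh (p * t) / (p * t)) / p - ln (sinh t / arctan (sinh t))) / t\<^sup>2"
      using elim(1) by (simp only: diff_divide_distrib)
    hence "ln (sinh t / arctan (sinh t)) < ln (sinh (p * t) / (p * t)) / p"
      by (simp add: zero_less_divide_iff)
    hence "exp (ln (sinh t / arctan (sinh t))) < exp (ln (sinh (p * t) / (p * t)) / p)"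
      by (rule exp_less_mono)
    thus ?case
      unfolding exp_ln[OF pos(1)] using pos assms elim by (simp add: powr_def)
  qed
qed

section \<open>The sharp order\<close>

theorem theorem3:
  fixes p :: real
  shows "(\<forall>a b :: real. a > 0 \<longrightarrow> b > 0 \<longrightarrow> a \<noteq> b \<longrightarrow>
            power_log_mean p a b < seiffert_mean a b) \<longleftrightarrow> p \<le> 2"
proof
  assume L: "\<forall>a b :: real. a > 0 \<longrightarrow> b > 0 \<longrightarrow> a \<noteq> b \<longrightarrow>
            power_log_mean p a b < seiffert_mean a b"
  show "p \<le> 2"
  proof (rule ccontr)
    assume "\<not> p \<le> 2"
    hence p: "p > 2" by simp
    have "\<forall>\<^sub>F t in at_right (0::real). t > 0 \<and>
        sinh t / arctan (sinh t) < (sinh (p * t) / (p * t)) powr (1 / p)"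
      using eventually_at_right_less eventually_seiffert_less_power_log[OF p]
      by (rule eventually_conj)
    then obtain t where t: "t > 0"
      "sinh t / arctan (sinh t) < (sinh (p * t) / (p * t)) powr (1 / p)"
      using eventually_happens'[OF trivial_limit_at_right_real] by blast
    have "power_log_mean p (1 * exp t) (1 * exp (- t)) < seiffert_mean (1 * exp t) (1 * exp (- t))"
      using L t(1) by simp
    hence "(sinh (p * t) / (p * t)) powr (1 / p) < sinh t / arctan (sinh t)"
      using t(1) p power_log_mean_exp[of 1 t p] seiffert_mean_exp[of 1 t] by simp
    thus False
      using t(2) by simp
  qed
next
  assume p: "p \<le> 2"
  have sorted: "power_log_mean p a b < seiffert_mean a b" if "0 < b" "b < a" for a b :: real
  proof -
    define t where "t = (ln a - ln b) / 2"
    define G where "G = exp ((ln a + ln b) / 2)"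
    have "a = G * exp t" "b = G * exp (- t)"
      using that by (simp_all add: G_def t_def flip: exp_add) (simp_all add: field_simps)
    moreover have "t > 0" "G > 0"
      using that by (simp_all add: G_def t_def)
    ultimately show ?thesis
      using power_log_mean_less_seiffert_mean[OF p] by simp
  qed
  have sym: "power_log_mean p a b = power_log_mean p b a" "seiffert_mean a b = seiffert_mean b a"
    if "a > 0" "b > 0" for a b :: real
  proof -
    have log_sym: "log_mean x y = log_mean y x" for x y
      unfolding log_mean_def by (metis minus_diff_eq minus_divide_divide)
    show "power_log_mean p a b = power_log_mean p b a"
      by (simp add: power_log_mean_def mult.commute log_sym[of "a powr p"])
    have "arcsin ((b - a) / (b + a)) = - arcsin ((a - b) / (a + b))"
    proof -
      have "(b - a) / (b + a) = - ((a - b) / (a + b))"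
        by (simp add: add.commute minus_divide_left)
      moreover have "- 1 \<le> (a - b) / (a + b)" "(a - b) / (a + b) \<le> 1"
        using that by (simp_all add: field_simps)
      ultimately show ?thesis by (simp add: arcsin_minus)
    qed
    thus "seiffert_mean a b = seiffert_mean b a"
      by (simp add: seiffert_mean_def) (simp add: divide_simps algebra_simps)
  qed
  show "\<forall>a b :: real. a > 0 \<longrightarrow> b > 0 \<longrightarrow> a \<noteq> b \<longrightarrow>
            power_log_mean p a b < seiffert_mean a b"
    using sorted sym by (metis linorder_neqE_linordered_idom)
qed

end
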